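(* Let $\delta\in(0,2)$ be a constant, let $r$ be a positive integer, let $\varepsilon>0$ satisfy $\varepsilon\ge r^{-\delta}$, and let $\mathbf{w}(i)=\sqrt{i}$ for $i\in\{0\}\cup[r]$. Then any piecewise linear function $\mathbf{f}$ providing a $(1+\varepsilon)$-approximation for $\mathbf{w}$ (i.e., $\mathbf{w}(i)\le\mathbf{f}(i)\le(1+\varepsilon)\mathbf{w}(i)$ for all $i\in\{0\}\cup[r]$) contains $\Omega(\log_{\gamma(\varepsilon)}r)$ linear pieces, where $\gamma(\varepsilon)=\big(1+2\varepsilon(2+\varepsilon)+2(1+\varepsilon)\sqrt{\varepsilon(2+\varepsilon)}\big)^2$; this bound behaves as $\Omega(\varepsilon^{-1/2}\log r)$ as $\varepsilon\to0$.
   Context: $[r]=\{1,\dots,r\}$. The implied constant in $\Omega(\cdot)$ may depend on $\delta$ but not on $r$ or $\varepsilon$. *)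

theory Defs
  imports "HOL-Analysis.Analysis" "HOL-Library.Disjoint_Sets"
begin

text \<open>
  Piecewise linearity is taken in its most general form: continuity at the breakpoints is not
  required, so the pieces form a partition of the domain into intervals of any kind (open,
  half-open, closed, or a single point).  For a continuous function on
  \<open>[0, r]\<close> with breakpoints \<open>0 = t\<^sub>0 < \<dots> < t\<^sub>k = r\<close> the pieces
  are \<open>[t\<^sub>0, t\<^sub>1], (t\<^sub>1, t\<^sub>2], \<dots>, (t\<^sub>k\<^sub>-\<^sub>1, t\<^sub>k]\<close>.
  Linear pieces may have a nonzero intercept.
\<close>

definition linear_pieces :: "real set \<Rightarrow> (real \<Rightarrow> real) \<Rightarrow> real set set \<Rightarrow> bool" where
  "linear_pieces S f P \<longleftrightarrow>
     finite P \<and> partition_on S P \<and>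
     (\<forall>I\<in>P. is_interval I \<and> (\<exists>a b. \<forall>x\<in>I. f x = a * x + b))"

definition piecewise_linear_on :: "real set \<Rightarrow> (real \<Rightarrow> real) \<Rightarrow> bool" where
  "piecewise_linear_on S f \<longleftrightarrow> (\<exists>P. linear_pieces S f P)"

text \<open>
  The same function can be cut into superfluous pieces, so its number of linear pieces is the
  smallest possible one; it is only meaningful for piecewise linear \<open>f\<close>.
\<close>

definition num_linear_pieces :: "real set \<Rightarrow> (real \<Rightarrow> real) \<Rightarrow> nat" where
  "num_linear_pieces S f = (LEAST k. \<exists>P. linear_pieces S f P \<and> card P = k)"

definition approximates :: "real \<Rightarrow> nat \<Rightarrow> (nat \<Rightarrow> real) \<Rightarrow> (real \<Rightarrow> real) \<Rightarrow> bool" where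
  "approximates \<epsilon> r w f \<longleftrightarrow>
     (\<forall>i\<in>{0..r}. w i \<le> f (real i) \<and> f (real i) \<le> (1 + \<epsilon>) * w i)"

definition \<gamma> :: "real \<Rightarrow> real" where
  "\<gamma> \<epsilon> = (1 + 2 * \<epsilon> * (2 + \<epsilon>) + 2 * (1 + \<epsilon>) * sqrt (\<epsilon> * (2 + \<epsilon>)))\<^sup>2"

end

theory Submission
  imports Defs
begin

text \<open>
  Put \<open>A = arcosh (1 + \<epsilon>)\<close>, so that \<open>\<gamma> \<epsilon> = exp (4 * A)\<close>.  If \<open>p < q\<close> and \<open>m\<close> are integers of one
  linear piece with \<open>m = sqrt (p * q) * exp (2 * \<theta>)\<close>, interpolating at \<open>m\<close> between \<open>p\<close> and \<open>q\<close>
  gives \<open>cosh (ln (q / p) / 4) \<le> cosh A * cosh \<theta>\<close>.  Rounding \<open>sqrt (p * q)\<close> up to \<open>m\<close> costs only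
  \<open>\<theta> \<le> A\<close> once \<open>p \<ge> 1 / A\<close>, whence \<open>q / p \<le> \<gamma> \<epsilon> ^ 2\<close>.  Since \<open>A \<ge> r powr (- \<delta> / 2)\<close>, this
  applies to all \<open>p \<ge> r powr (\<delta> / 2)\<close>, and the integers obtained by rounding up the points
  \<open>r powr (\<delta> / 2) * \<gamma> \<epsilon> ^ (3 * j)\<close> not exceeding \<open>r\<close> lie in pairwise different pieces.
\<close>

section \<open>Hyperbolic form of \<open>\<gamma>\<close> and bounds on
  \<open>arcosh (1 + \<epsilon>)\<close>\<close>

lemma exp_arcosh_real:
  fixes x :: real
  assumes "x \<ge> 1"
  shows "exp (arcosh x) = x + sqrt (x\<^sup>2 - 1)"
proof -
  have "x + sqrt (x\<^sup>2 - 1) > 0"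
    using assms by (simp add: add_pos_nonneg)
  thus ?thesis using assms by (simp add: arcosh_real_def)
qed

text \<open>Squaring \<open>1 + \<epsilon> + sqrt (\<epsilon> * (2 + \<epsilon>))\<close> once gives
  the base in the definition of \<open>\<gamma>\<close>; the outer square there doubles the exponent
  again.\<close>

lemma gamma_eq_exp_arcosh:
  assumes "\<epsilon> \<ge> 0"
  shows "\<gamma> \<epsilon> = exp (4 * arcosh (1 + \<epsilon>))"
proof -
  have nn: "\<epsilon> * (2 + \<epsilon>) \<ge> 0" using assms by simp
  have eq: "(1 + \<epsilon>)\<^sup>2 - 1 = \<epsilon> * (2 + \<epsilon>)" by (simp add: power2_eq_square algebra_simps)
  have "exp (arcosh (1 + \<epsilon>)) = 1 + \<epsilon> + sqrt (\<epsilon> * (2 + \<epsilon>))"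
    using exp_arcosh_real[of "1 + \<epsilon>"] assms by (simp add: eq)
  hence "(exp (arcosh (1 + \<epsilon>)))\<^sup>2 = (1 + \<epsilon>)\<^sup>2 + 2 * (1 + \<epsilon>) * sqrt (\<epsilon> * (2 + \<epsilon>)) + \<epsilon> * (2 + \<epsilon>)"
    using nn by (simp add: power2_sum)
  also have "\<dots> = 1 + 2 * \<epsilon> * (2 + \<epsilon>) + 2 * (1 + \<epsilon>) * sqrt (\<epsilon> * (2 + \<epsilon>))"
    by (simp add: power2_eq_square algebra_simps)
  finally have "\<gamma> \<epsilon> = ((exp (arcosh (1 + \<epsilon>)))\<^sup>2)\<^sup>2"
    by (simp add: \<gamma>_def)
  also have "\<dots> = exp (4 * arcosh (1 + \<epsilon>))"
    by (simp flip: exp_double)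
  finally show ?thesis .
qed

lemma log_gamma_eq:
  assumes "\<epsilon> > 0"
  shows "log (\<gamma> \<epsilon>) x = ln x / (4 * arcosh (1 + \<epsilon>))"
  using assms by (simp add: log_def gamma_eq_exp_arcosh)

lemma arcosh_one_plus_le:
  assumes "0 \<le> \<epsilon>" "\<epsilon> \<le> (1::real)"
  shows "arcosh (1 + \<epsilon>) \<le> 3 * sqrt \<epsilon>"
proof -
  have "sqrt (\<epsilon> * (2 + \<epsilon>)) \<le> sqrt (\<epsilon> * 4)"
    using assms by (intro real_sqrt_le_mono mult_left_mono) auto
  also have "\<dots> = 2 * sqrt \<epsilon>" by (simp add: real_sqrt_mult)
  finally have 1: "sqrt ((1 + \<epsilon>)\<^sup>2 - 1) \<le> 2 * sqrt \<epsilon>"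
    by (simp add: power2_eq_square algebra_simps)
  have 2: "\<epsilon> \<le> sqrt \<epsilon>"
    using assms by (intro real_le_rsqrt) (simp add: power2_eq_square mult_left_le)
  have "exp (arcosh (1 + \<epsilon>)) \<le> 1 + 3 * sqrt \<epsilon>"
    using 1 2 assms by (simp add: exp_arcosh_real)
  also have "\<dots> \<le> exp (3 * sqrt \<epsilon>)" by (rule exp_ge_add_one_self)
  finally show ?thesis by simp
qed

text \<open>For \<open>s\<close> in the unit interval, \<open>exp s\<close> is at most
  \<open>1 + s + s\<^sup>2\<close>, which is matched term by term with
  \<open>1 + \<epsilon> + sqrt (\<epsilon> * (2 + \<epsilon>))\<close>. This converts the lower
  bound on \<open>\<epsilon>\<close> into one on \<open>arcosh (1 + \<epsilon>)\<close>.\<close>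

lemma arcosh_one_plus_ge:
  assumes "0 \<le> s" "s \<le> 1" "s\<^sup>2 \<le> (\<epsilon>::real)"
  shows "s \<le> arcosh (1 + \<epsilon>)"
proof -
  have "0 \<le> \<epsilon>" using assms zero_le_power2[of s] by linarith
  have "s \<le> sqrt ((1 + \<epsilon>)\<^sup>2 - 1)"
  proof (rule real_le_rsqrt)
    show "s\<^sup>2 \<le> (1 + \<epsilon>)\<^sup>2 - 1"
      using assms(3) \<open>0 \<le> \<epsilon>\<close> zero_le_power2[of \<epsilon>]
      unfolding power2_sum one_power2 mult_1_right by linarith
  qed
  moreover have "exp s \<le> 1 + s + s\<^sup>2" using assms by (intro exp_bound) auto
  ultimately have "exp s \<le> exp (arcosh (1 + \<epsilon>))"
    using assms \<open>0 \<le> \<epsilon>\<close> by (simp add: exp_arcosh_real)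
  thus ?thesis by simp
qed

section \<open>How far one linear piece can reach\<close>

lemma affine_sqrt_interpolation:
  fixes p q m k a b :: real
  assumes "0 < p" "p \<le> m" "m \<le> q" "p < q"
    and "a * p + b \<le> k * sqrt p" "a * q + b \<le> k * sqrt q" "sqrt m \<le> a * m + b"
  shows "sqrt m * (sqrt p + sqrt q) \<le> k * (sqrt p * sqrt q + m)"
proof -
  define s t where "s = sqrt p" and "t = sqrt q"
  have s: "s > 0" "s < t" "p = s\<^sup>2" "q = t\<^sup>2"
    using assms by (auto simp: s_def t_def)
  \<comment> \<open>Scaled by \<open>q - p\<close>, the affine value at \<open>m\<close> is a
    weighted sum of those at \<open>p\<close> and \<open>q\<close>. Its upper bound contains the
    factor \<open>t - s\<close>, which cancels against \<open>t\<^sup>2 - s\<^sup>2\<close>.\<close>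
  have "(t\<^sup>2 - s\<^sup>2) * sqrt m \<le> (q - p) * (a * m + b)"
  proof (rule mult_mono)
    show "0 \<le> sqrt m" using assms(1,2) by simp
    show "0 \<le> q - p" using assms(4) by simp
    show "t\<^sup>2 - s\<^sup>2 \<le> q - p" unfolding s(3,4) by simp
  qed (use assms in simp)
  also have "\<dots> = (q - m) * (a * p + b) + (m - p) * (a * q + b)"
    by (simp add: algebra_simps)
  also have "\<dots> \<le> (q - m) * (k * s) + (m - p) * (k * t)"
    using assms unfolding s_def t_def by (intro add_mono mult_left_mono) auto
  also have "\<dots> = (t - s) * (k * (s * t + m))"
    unfolding s(3,4) by (simp add: algebra_simps power2_eq_square)
  finally have "(t - s) * (sqrt m * (s + t)) \<le> (t - s) * (k * (s * t + m))"
    by (simp add: algebra_simps power2_eq_square)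
  thus ?thesis using s(2) by (simp flip: s_def t_def)
qed

lemma sqrt_exp: "sqrt (exp x) = exp (x / 2)"
  by (rule real_sqrt_unique) (simp_all flip: exp_double)

lemma exp_add_exp_eq_cosh: "exp x + exp y = 2 * exp ((x + y) / 2) * cosh ((x - y) / (2::real))"
proof -
  have "2 * exp ((x + y) / 2) * cosh ((x - y) / 2)
      = exp ((x + y) / 2 + (x - y) / 2) + exp ((x + y) / 2 + - ((x - y) / 2))"
    unfolding exp_add cosh_field_def by (simp add: field_simps)
  thus ?thesis by (simp add: field_simps)
qed

text \<open>In logarithmic coordinates both sides of the interpolation inequality are sums of two
  exponentials with the same mean exponent. Dividing out that common factor leaves only the two
  hyperbolic cosines.\<close>

lemma affine_sqrt_interpolation_cosh:
  fixes \<alpha> \<beta> \<mu> k a b :: real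
  assumes "\<alpha> \<le> \<mu>" "\<mu> \<le> \<beta>" "\<alpha> < \<beta>"
    and "a * exp \<alpha> + b \<le> k * sqrt (exp \<alpha>)" "a * exp \<beta> + b \<le> k * sqrt (exp \<beta>)"
    and "sqrt (exp \<mu>) \<le> a * exp \<mu> + b"
  shows "cosh ((\<beta> - \<alpha>) / 4) \<le> k * cosh ((\<mu> - (\<alpha> + \<beta>) / 2) / 2)"
proof -
  have "sqrt (exp \<mu>) * (sqrt (exp \<alpha>) + sqrt (exp \<beta>))
          \<le> k * (sqrt (exp \<alpha>) * sqrt (exp \<beta>) + exp \<mu>)"
    using assms by (intro affine_sqrt_interpolation[where a = a and b = b]) auto
  hence "exp (\<mu> / 2) * (exp (\<beta> / 2) + exp (\<alpha> / 2)) \<le> k * (exp \<mu> + exp ((\<alpha> + \<beta>) / 2))"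
    by (simp add: sqrt_exp add.commute add_divide_distrib flip: exp_add)
  moreover have "exp (\<mu> / 2) * (exp (\<beta> / 2) + exp (\<alpha> / 2))
      = 2 * exp ((\<mu> + (\<alpha> + \<beta>) / 2) / 2) * cosh ((\<beta> - \<alpha>) / 4)"
  proof -
    have "exp ((\<mu> + (\<alpha> + \<beta>) / 2) / 2) = exp (\<mu> / 2) * exp ((\<beta> / 2 + \<alpha> / 2) / 2)"
      unfolding exp_add[symmetric] by (simp add: field_simps)
    moreover have "(\<beta> / 2 - \<alpha> / 2) / 2 = (\<beta> - \<alpha>) / 4" by simp
    ultimately show ?thesis
      by (simp only: exp_add_exp_eq_cosh mult_ac)
  qed
  moreover have "k * (exp \<mu> + exp ((\<alpha> + \<beta>) / 2))
      = 2 * exp ((\<mu> + (\<alpha> + \<beta>) / 2) / 2) * (k * cosh ((\<mu> - (\<alpha> + \<beta>) / 2) / 2))"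
    by (simp only: exp_add_exp_eq_cosh mult_ac)
  ultimately show ?thesis
    by (metis exp_gt_zero mult_le_cancel_left_pos mult_pos_pos zero_less_numeral)
qed

lemma linear_piece_ratio_le:
  fixes p q :: nat and A a b :: real
  assumes A: "A > 0" and pA: "1 \<le> A * real p" and pq: "p \<le> q"
    and lower: "\<And>i. p \<le> i \<Longrightarrow> i \<le> q \<Longrightarrow> sqrt (real i) \<le> a * real i + b"
    and upper: "\<And>i. p \<le> i \<Longrightarrow> i \<le> q \<Longrightarrow> a * real i + b \<le> cosh A * sqrt (real i)"
  shows "real q \<le> exp (8 * A) * real p"
proof (rule ccontr)
  assume "\<not> ?thesis"
  hence gt: "real q > exp (8 * A) * real p" by simp
  have p0: "p > 0" using pA by (cases p) auto
  define \<alpha> \<beta> where "\<alpha> = ln (real p)" and "\<beta> = ln (real q)"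
  have ea: "exp \<alpha> = real p" and eb: "exp \<beta> = real q"
    using p0 pq by (auto simp: \<alpha>_def \<beta>_def)
  have "exp (8 * A + \<alpha>) < exp \<beta>" using gt by (simp add: exp_add ea eb)
  hence ab: "8 * A + \<alpha> < \<beta>" by simp
  define g where "g = exp ((\<alpha> + \<beta>) / 2)"
  have "exp \<alpha> \<le> g" unfolding g_def using ab A by simp
  hence "A * real p \<le> A * g" using A by (simp add: ea)
  \<comment> \<open>Hence adding 1 when rounding \<open>g\<close> up costs at most a factor
    \<open>1 + A\<close>, which is below \<open>exp A\<close>.\<close>
  hence "1 \<le> A * g" using pA by linarith
  define m where "m = nat \<lceil>g\<rceil>"
  have g0: "g > 0" by (simp add: g_def)
  have m: "g \<le> real m" "real m \<le> g + 1"
    using g0 unfolding m_def by linarith+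
  define \<mu> where "\<mu> = ln (real m)"
  have em: "exp \<mu> = real m" using m g0 by (auto simp: \<mu>_def)
  have "exp ((\<alpha> + \<beta>) / 2) \<le> exp \<mu>" using m by (simp add: em g_def)
  hence mu1: "(\<alpha> + \<beta>) / 2 \<le> \<mu>" by simp
  have "exp \<mu> \<le> g * (1 + A)" using m \<open>1 \<le> A * g\<close> by (simp add: em algebra_simps)
  also have "\<dots> \<le> g * exp A" using g0 by (intro mult_left_mono exp_ge_add_one_self) auto
  also have "\<dots> = exp ((\<alpha> + \<beta>) / 2 + A)" by (simp add: g_def exp_add)
  finally have mu2: "\<mu> \<le> (\<alpha> + \<beta>) / 2 + A" by simp
  \<comment> \<open>The negated claim leaves room for the rounded midpoint: half the gap exceeds
    \<open>4 * A\<close>, so \<open>m\<close> does not pass \<open>q\<close>.\<close>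
  have "(\<alpha> + \<beta>) / 2 + A \<le> \<beta>" "\<alpha> \<le> (\<alpha> + \<beta>) / 2"
    using ab A by (simp_all add: field_simps)
  hence mu3: "\<alpha> \<le> \<mu>" "\<mu> \<le> \<beta>"
    using mu1 mu2 by (blast intro: order_trans)+
  hence "exp \<alpha> \<le> exp \<mu>" "exp \<mu> \<le> exp \<beta>" by simp_all
  hence pm: "p \<le> m" "m \<le> q" by (simp_all add: ea eb em)
  have "cosh ((\<beta> - \<alpha>) / 4) \<le> cosh A * cosh ((\<mu> - (\<alpha> + \<beta>) / 2) / 2)"
    using mu3 ab A lower[OF pm] upper[of p] upper[of q] pq
    by (intro affine_sqrt_interpolation_cosh[where a = a and b = b]) (auto simp: ea eb em)
  \<comment> \<open>The crude bound \<open>A\<close> on the offset makes the product a square, at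
    most \<open>cosh (2 * A)\<close>; four times \<open>2 * A\<close> is the 8 in the claim.\<close>
  also have "\<dots> \<le> cosh A * cosh A"
    using mu1 mu2 A by (intro mult_left_mono) (auto simp: cosh_real_nonneg_le_iff)
  also have "\<dots> \<le> cosh (2 * A)"
    by (simp add: cosh_double power2_eq_square)
  finally have "(\<beta> - \<alpha>) / 4 \<le> 2 * A"
    using ab A by (subst (asm) cosh_real_nonneg_le_iff) auto
  thus False using ab by simp
qed

section \<open>Counting pieces by separated points\<close>

lemma num_linear_pieces_attained:
  assumes "piecewise_linear_on S f"
  obtains P where "linear_pieces S f P" "card P = num_linear_pieces S f"
proof -
  have "\<exists>k P. linear_pieces S f P \<and> card P = k"
    using assms by (auto simp: piecewise_linear_on_def)
  from LeastI_ex[OF this] show ?thesis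
    using that by (auto simp: num_linear_pieces_def)
qed

text \<open>No piece of a minimal partition holds two points of \<open>X\<close>, so sending each
  point to its piece is injective. Stating \<open>sep\<close> for arbitrary intervals on which
  \<open>f\<close> is affine keeps the partition out of later arguments.\<close>

lemma card_le_num_linear_pieces:
  assumes "piecewise_linear_on S f" "X \<subseteq> S"
    and sep: "\<And>I x y a b. \<lbrakk>is_interval I; I \<subseteq> S; \<forall>z\<in>I. f z = a * z + b;
                x \<in> I \<inter> X; y \<in> I \<inter> X; x < y\<rbrakk> \<Longrightarrow> False"
  shows "card X \<le> num_linear_pieces S f"
proof -
  obtain P where P: "linear_pieces S f P" "card P = num_linear_pieces S f"
    using num_linear_pieces_attained assms(1) by blast
  have fin: "finite P" and part: "partition_on S P"
    and lin: "\<And>I. I \<in> P \<Longrightarrow> is_interval I \<and> (\<exists>a b. \<forall>x\<in>I. f x = a * x + b)"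
    using P(1) by (auto simp: linear_pieces_def)
  have US: "\<Union>P = S" using part by (simp add: partition_on_def)
  have "\<forall>x\<in>X. \<exists>I\<in>P. x \<in> I" using US assms(2) by blast
  then obtain h where h: "\<And>x. x \<in> X \<Longrightarrow> h x \<in> P \<and> x \<in> h x" by metis
  have "inj_on h X"
  proof (rule linorder_inj_onI')
    fix x y assume xy: "x \<in> X" "y \<in> X" "x < y"
    show "h x \<noteq> h y"
    proof
      assume eq: "h x = h y"
      obtain a b where "\<forall>z\<in>h x. f z = a * z + b" using lin h xy by blast
      thus False
        using sep[of "h x" a b x y] lin[of "h x"] h[of x] h[of y] xy eq US by auto
    qed
  qed
  hence "card X \<le> card P"
    using h fin by (intro card_inj_on_le[of h]) auto
  thus ?thesis using P by simp
qed

text \<open>The separated points cover a logarithmic range of length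
  \<open>(1 - \<delta> / 2) * ln r\<close> in steps of \<open>3 * ln (\<gamma> \<epsilon>)\<close>,
  whence the factor \<open>(2 - \<delta>) / 6\<close>.\<close>

lemma num_linear_pieces_lower_bound:
  fixes r :: nat and \<delta> \<epsilon> :: real
  assumes \<delta>: "0 < \<delta>" "\<delta> < 2" and r: "r \<ge> 1" and e: "\<epsilon> > 0" "\<epsilon> \<ge> real r powr (- \<delta>)"
    and pw: "piecewise_linear_on {0..real r} f"
    and appr: "approximates \<epsilon> r (\<lambda>i. sqrt (real i)) f"
  shows "(2 - \<delta>) / 6 * log (\<gamma> \<epsilon>) (real r) \<le> real (num_linear_pieces {0..real r} f)"
proof -
  define A where "A = arcosh (1 + \<epsilon>)"
  define L where "L = ln (real r)"
  have L0: "L \<ge> 0" using r by (simp add: L_def)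
  have eL: "exp L = real r" using r by (simp add: L_def)
  have A0: "A > 0" using e by (simp add: A_def)
  have coshA: "cosh A = 1 + \<epsilon>" using e by (simp add: A_def)
  have "exp (- (\<delta> / 2) * L) \<le> A"
    unfolding A_def
  proof (rule arcosh_one_plus_ge)
    show "exp (- (\<delta> / 2) * L) \<le> 1" using L0 \<delta> by simp
    have "(exp (- (\<delta> / 2) * L))\<^sup>2 = real r powr (- \<delta>)"
      using r by (simp add: powr_def L_def flip: exp_double)
    thus "(exp (- (\<delta> / 2) * L))\<^sup>2 \<le> \<epsilon>" using e by simp
  qed simp
  hence "exp (- (\<delta> / 2) * L) * exp (\<delta> / 2 * L) \<le> A * exp (\<delta> / 2 * L)"
    by (intro mult_right_mono) auto
  hence A1: "1 \<le> A * exp (\<delta> / 2 * L)" by (simp flip: exp_add)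

  \<comment> \<open>The spacing \<open>12 * A\<close> has to exceed \<open>9 * A\<close>:
    \<open>8 * A\<close> for the reach of a piece and \<open>A\<close> for rounding the smaller
    point up.\<close>
  define x where "x j = exp (\<delta> / 2 * L + 12 * A * real j)" for j
  define n where "n j = nat \<lceil>x j\<rceil>" for j
  define N where "N = nat \<lfloor>(1 - \<delta> / 2) * L / (12 * A)\<rfloor>"
  have x0: "x j > 0" for j by (simp add: x_def)
  have n1: "x j \<le> real (n j)" for j by (simp add: n_def real_nat_ceiling_ge)
  have n1': "real (n j) \<le> x j + 1" for j
    using x0[of j] unfolding n_def by linarith
  have xA: "1 \<le> A * x j" for j
  proof -
    have "exp (\<delta> / 2 * L) \<le> x j" using A0 by (simp add: x_def)
    hence "A * exp (\<delta> / 2 * L) \<le> A * x j" using A0 by simp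
    thus ?thesis using A1 by linarith
  qed
  have n2: "real (n j) \<le> x j * exp A" for j
  proof -
    have "real (n j) \<le> x j * (1 + A)" using n1'[of j] xA[of j] by (simp add: algebra_simps)
    also have "\<dots> \<le> x j * exp A" using x0[of j] by (intro mult_left_mono exp_ge_add_one_self) auto
    finally show ?thesis .
  qed
  have nA: "1 \<le> A * real (n j)" for j
    using xA[of j] n1[of j] A0 by (meson mult_left_mono less_imp_le order_trans)
  have grow: "exp (8 * A) * real (n i) < real (n j)" if "i < j" for i j
  proof -
    have "exp (8 * A) * real (n i) \<le> exp (8 * A) * (x i * exp A)"
      by (intro mult_left_mono n2) auto
    also have "\<dots> = exp (\<delta> / 2 * L + 12 * A * real i + 9 * A)"
      by (simp add: x_def flip: exp_add)
    also have "\<dots> < x j"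
    proof -
      have "12 * A * (real i + 1) \<le> 12 * A * real j" using that A0 by (intro mult_left_mono) auto
      thus ?thesis using A0 by (simp add: x_def algebra_simps)
    qed
    finally show ?thesis using n1[of j] by linarith
  qed
  have "strict_mono n"
  proof (rule strict_monoI)
    fix i j :: nat assume "i < j"
    have "1 * real (n i) \<le> exp (8 * A) * real (n i)" using A0 by (intro mult_right_mono) auto
    thus "n i < n j" using grow[OF \<open>i < j\<close>] by simp
  qed
  have nr: "n j \<le> r" if "j \<le> N" for j
  proof -
    have q0: "(1 - \<delta> / 2) * L / (12 * A) \<ge> 0" using \<delta> L0 A0 by simp
    have "real j \<le> real N" using that by simp
    also have "\<dots> \<le> (1 - \<delta> / 2) * L / (12 * A)" unfolding N_def using q0 by linarith
    finally have "real j * (12 * A) \<le> (1 - \<delta> / 2) * L" using A0 by (simp add: pos_le_divide_eq)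
    hence "x j \<le> exp L" unfolding x_def by (simp add: algebra_simps)
    \<comment> \<open>Rounding up cannot leave the domain because \<open>r\<close> is itself an
      integer.\<close>
    thus ?thesis by (simp add: n_def eL ceiling_le_iff)
  qed

  define X where "X = (\<lambda>j. real (n j)) ` {..N}"
  \<comment> \<open>Counting \<open>j = 0\<close> as well makes up for the floor in
    \<open>N\<close>, so no additive term is lost.\<close>
  have "card X = N + 1"
    unfolding X_def using \<open>strict_mono n\<close>
    by (subst card_image) (auto simp: inj_on_def strict_mono_eq)
  moreover have "card X \<le> num_linear_pieces {0..real r} f"
  proof (rule card_le_num_linear_pieces[OF pw])
    show "X \<subseteq> {0..real r}" using nr by (auto simp: X_def)
  next
    fix I u v a b
    assume I: "is_interval I" "I \<subseteq> {0..real r}" and lin: "\<forall>z\<in>I. f z = a * z + b"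
      and "u \<in> I \<inter> X" "v \<in> I \<inter> X" "u < v"
    then obtain i j where ij: "u = real (n i)" "v = real (n j)" "j \<le> N"
      and uI: "real (n i) \<in> I" "real (n j) \<in> I"
      by (auto simp: X_def)
    have nij: "n i < n j" using \<open>u < v\<close> ij by simp
    hence "i < j" using \<open>strict_mono n\<close> by (simp add: strict_mono_less)
    have ap: "sqrt (real l) \<le> a * real l + b \<and> a * real l + b \<le> cosh A * sqrt (real l)"
      if "n i \<le> l" "l \<le> n j" for l
    proof -
      have "real l \<in> I" using I(1) uI that unfolding is_interval_1 by fastforce
      moreover have "l \<le> r" using that nr[OF ij(3)] by simp
      moreover from this have "sqrt (real l) \<le> f (real l)"
          "f (real l) \<le> (1 + \<epsilon>) * sqrt (real l)"
        using appr by (auto simp: approximates_def)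
      ultimately show ?thesis
        using lin by (metis coshA)
    qed
    have "real (n j) \<le> exp (8 * A) * real (n i)"
      using ap nij by (intro linear_piece_ratio_le[OF A0 nA, where a = a and b = b]) auto
    thus False using grow[OF \<open>i < j\<close>] by simp
  qed
  ultimately have "real N + 1 \<le> real (num_linear_pieces {0..real r} f)" by simp
  moreover have "(1 - \<delta> / 2) * L / (12 * A) \<le> real N + 1"
    unfolding N_def by linarith
  moreover have "(2 - \<delta>) / 6 * log (\<gamma> \<epsilon>) (real r) = (1 - \<delta> / 2) * L / (12 * A)"
    unfolding log_gamma_eq[OF e(1)] A_def[symmetric] L_def[symmetric]
    using A0 by (simp add: field_simps)
  ultimately show ?thesis by linarith
qed

text \<open>Since \<open>ln (\<gamma> \<epsilon>) = 4 * arcosh (1 + \<epsilon>)\<close> is at most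
  \<open>12 * sqrt \<epsilon>\<close>, the constant is 1/12.\<close>

lemma log_gamma_ge:
  assumes "0 < \<epsilon>" "\<epsilon> < 1" "x \<ge> 1"
  shows "1 / 12 * (\<epsilon> powr (- 1 / 2) * ln x) \<le> log (\<gamma> \<epsilon>) x"
proof -
  have A0: "arcosh (1 + \<epsilon>) > 0" using assms by simp
  have "ln x / (12 * sqrt \<epsilon>) \<le> ln x / (4 * arcosh (1 + \<epsilon>))"
    using assms A0 arcosh_one_plus_le[of \<epsilon>] by (intro divide_left_mono) auto
  moreover have "\<epsilon> powr (- 1 / 2) = 1 / sqrt \<epsilon>"
    using assms powr_minus_divide[of \<epsilon> "1 / 2"] by (simp add: powr_half_sqrt)
  ultimately show ?thesis using assms by (simp add: log_gamma_eq)
qed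

theorem theorem9:
  fixes \<delta> :: real
  assumes "0 < \<delta>" and "\<delta> < 2"
  shows "(\<exists>c>0. \<forall>(r::nat) (\<epsilon>::real) (f::real \<Rightarrow> real).
            r \<ge> 1 \<longrightarrow> \<epsilon> > 0 \<longrightarrow> \<epsilon> \<ge> real r powr (- \<delta>) \<longrightarrow>
            piecewise_linear_on {0..real r} f \<longrightarrow>
            approximates \<epsilon> r (\<lambda>i. sqrt (real i)) f \<longrightarrow>
            real (num_linear_pieces {0..real r} f) \<ge> c * log (\<gamma> \<epsilon>) (real r))
       \<and> (\<exists>C>0. \<forall>\<^sub>F \<epsilon> in at_right (0::real). \<forall>r::nat. r \<ge> 1 \<longrightarrow>
            log (\<gamma> \<epsilon>) (real r) \<ge> C * (\<epsilon> powr (- 1 / 2) * ln (real r)))"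
proof (intro conjI exI allI impI)
  show "(2 - \<delta>) / 6 > 0" using assms by simp
  show "(1 / 12 :: real) > 0" by simp
  show "\<forall>\<^sub>F \<epsilon> in at_right (0::real). \<forall>r::nat. r \<ge> 1 \<longrightarrow>
          log (\<gamma> \<epsilon>) (real r) \<ge> 1 / 12 * (\<epsilon> powr (- 1 / 2) * ln (real r))"
    by (rule eventually_mono[OF eventually_at_right_real[OF zero_less_one]])
      (use log_gamma_ge in auto)
qed (use assms num_linear_pieces_lower_bound in blast)

end
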